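(* Let $G$ be an $r$-regular graph with $n\ge 2$ vertices and $m$ edges, and let $\lambda_1=r\ge\lambda_2\ge\dots\ge\lambda_n$ be the eigenvalues of the adjacency matrix $A(G)$, indexed so that $\lambda_1=r$ corresponds to the all-ones eigenvector. Put $P(\lambda_1)=n$ and $P(\lambda_i)=0$ for $2\le i\le n$ (these are the eigenvalues of $J_n$ on a common eigenbasis of $A(G)$ and $J_n$). Then the normalized Laplacian characteristic polynomial $f(\mathcal{L}(C(G)),x)=\det\big(xI-\mathcal{L}(C(G))\big)$ of the central graph $C(G)$ equals $$(x-1)^{m-n}\prod_{i=1}^{n}\left((x-1)\Big((x-1)+\frac{P(\lambda_i)-1-\lambda_i}{n-1}\Big)-\frac{\lambda_i+r}{2(n-1)}\right).$$
   Context: All graphs are finite, simple and undirected. The central graph $C(G)$ of a graph $G$ with $n$ vertices and $m$ edges is obtained by subdividing each edge of $G$ exactly once (inserting one new vertex on each edge) and joining every pair of vertices of $G$ that are non-adjacent in $G$; it has $n+m$ vertices. For a graph $H$ with degree matrix $D(H)$ and adjacency matrix $A(H)$, the normalized Laplacian is the matrix $\mathcal{L}(H)$ with $(i,j)$ entry $1$ if $i=j$ and $d_i\neq 0$, $-1/\sqrt{d_id_j}$ if $v_i\sim v_j$, and $0$ otherwise; i.e. $\mathcal{L}(H)=I-D(H)^{-1/2}A(H)D(H)^{-1/2}$ when there are no isolated vertices. $J_n$ is the $n\times n$ all-ones matrix. *)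

theory Defs
  imports
    "Graph_Theory.Pair_Digraph"
    "Jordan_Normal_Form.Char_Poly"
    "HOL-Computational_Algebra.Normalized_Fraction"
begin

text \<open>
  A finite simple undirected graph is a symmetric irreflexive relation on a finite vertex set,
  i.e. a \<open>pair_graph\<close>.  Each undirected edge is represented by two opposite arcs, so edges have
  to be counted through their endpoint sets.
\<close>

definition uedges :: "'a pair_pre_digraph \<Rightarrow> 'a set set" where
  "uedges G = {{u, v} | u v. (u, v) \<in> parcs G}"

definition degree_of :: "'a pair_pre_digraph \<Rightarrow> 'a \<Rightarrow> nat" where
  "degree_of G v = out_degree (with_proj G) v"

definition regular_graph :: "'a pair_pre_digraph \<Rightarrow> nat \<Rightarrow> bool" where
  "regular_graph G r \<longleftrightarrow> pair_graph G \<and> (\<forall>v \<in> pverts G. degree_of G v = r)"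

text \<open>
  In the central graph, \<open>Inl v\<close> is the original vertex \<open>v\<close> and \<open>Inr e\<close> the vertex inserted on
  the edge \<open>e\<close>.  The edges of \<open>G\<close> itself disappear.
\<close>

definition central_graph :: "'a pair_pre_digraph \<Rightarrow> ('a + 'a set) pair_pre_digraph" where
  "central_graph G =
     \<lparr> pverts = Inl ` pverts G \<union> Inr ` uedges G,
       parcs = {(Inl v, Inr e) | v e. e \<in> uedges G \<and> v \<in> e}
             \<union> {(Inr e, Inl v) | v e. e \<in> uedges G \<and> v \<in> e}
             \<union> {(Inl u, Inl v) | u v. u \<in> pverts G \<and> v \<in> pverts G \<and> u \<noteq> v \<and> (u, v) \<notin> parcs G} \<rparr>"

text \<open>
  Matrices of a graph are taken with respect to an enumeration \<open>vs\<close> of its vertices.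
\<close>

definition vertex_enum :: "'a pair_pre_digraph \<Rightarrow> 'a list \<Rightarrow> bool" where
  "vertex_enum G vs \<longleftrightarrow> distinct vs \<and> set vs = pverts G"

definition adjacency_matrix :: "'a pair_pre_digraph \<Rightarrow> 'a list \<Rightarrow> real mat" where
  "adjacency_matrix G vs = mat (length vs) (length vs)
     (\<lambda>(i, j). if (vs ! i, vs ! j) \<in> parcs G then 1 else 0)"

definition normalized_laplacian :: "'a pair_pre_digraph \<Rightarrow> 'a list \<Rightarrow> real mat" where
  "normalized_laplacian G vs = mat (length vs) (length vs)
     (\<lambda>(i, j).
        if i = j \<and> degree_of G (vs ! i) \<noteq> 0 then 1
        else if (vs ! i, vs ! j) \<in> parcs G
          then - 1 / sqrt (real (degree_of G (vs ! i)) * real (degree_of G (vs ! j)))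
        else 0)"

lemma (in pair_graph) finite_uedges: "finite (uedges G)"
proof -
  have "uedges G = (\<lambda>(u, v). {u, v}) ` parcs G"
    by (auto simp: uedges_def)
  then show ?thesis using pair_finite_arcs by simp
qed

lemma (in pair_graph) pair_graph_central_graph: "pair_graph (central_graph G)"
proof -
  let ?C = "central_graph G"
  have sub: "v \<in> pverts G" if "e \<in> uedges G" "v \<in> e" for e v
    using that by (auto simp: uedges_def dest: in_arcsD1 in_arcsD2)
  have wf: "parcs ?C \<subseteq> pverts ?C \<times> pverts ?C"
    by (auto simp: central_graph_def dest: sub)
  have fin: "finite (pverts ?C)"
    using pair_finite_verts finite_uedges by (simp add: central_graph_def)
  have "finite (parcs ?C)"
    using wf fin by (meson finite_SigmaI finite_subset)
  moreover have "symmetric (with_proj ?C)"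
    using arcs_symmetric by (auto simp: symmetric_def sym_def central_graph_def)
  moreover have "fst a \<noteq> snd a" if "a \<in> parcs ?C" for a
    using that by (auto simp: central_graph_def)
  ultimately show ?thesis
    using wf fin by unfold_locales auto
qed

lemma (in pair_graph) card_central_graph:
  "card (pverts (central_graph G)) = card (pverts G) + card (uedges G)"
proof -
  have "card (pverts (central_graph G)) = card (pverts G <+> uedges G)"
    by (simp add: central_graph_def Plus_def)
  then show ?thesis
    using pair_finite_verts finite_uedges by (simp add: card_Plus)
qed

end

theory Submission
  imports Defs
begin

text \<open>
  Ordering the vertices of \<open>C(G)\<close> as original vertices followed by edges, the Schur complement
  of the edge block turns the characteristic polynomial at \<open>y + 1\<close> into \<open>y\<close>-powers times
  \<open>det (a I + b A + c J)\<close>, since the incidence matrix \<open>B\<close> satisfies \<open>B B\<^sup>T = A + r I\<close>.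
  No spectral theorem is needed: \<open>A J = r J\<close> gives
  \<open>a I + b A + c J = (a I + b A) (I + c / (a + b r) J)\<close> whenever \<open>a + b r \<noteq> 0\<close>, and the
  determinants of both factors are known.  As \<open>a + b r > 0\<close> for all large \<open>y\<close>, this determines
  the polynomial.
\<close>

section \<open>Determinants\<close>

text \<open>The sign of \<open>p\<close> enters twice, once for the rows and once, through the
  transpose, for the columns; the two signs cancel.\<close>

lemma det_permute_rows_cols:
  fixes A :: "'a :: comm_ring_1 mat"
  assumes A: "A \<in> carrier_mat n n" and p: "p permutes {0..<n}"
  shows "det (mat n n (\<lambda>(i, j). A $$ (p i, p j))) = det A"
proof -
  have pn: "p i < n" if "i < n" for i
    using permutes_in_image[OF p] that by simp
  let ?R = "mat n n (\<lambda>(i, j). A $$ (p i, j))"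
  have "det (mat n n (\<lambda>(i, j). A $$ (p i, p j))) =
        det (mat n n (\<lambda>(i, j). transpose_mat ?R $$ (p i, j)))"
    by (subst det_transpose[of _ n, symmetric], simp)
      (rule arg_cong[of _ _ det], rule eq_matI, auto simp: pn)
  also have "\<dots> = signof p * det (transpose_mat ?R)"
    by (rule det_permute_rows[OF _ p]) simp
  also have "det (transpose_mat ?R) = signof p * det A"
    by (subst det_transpose[of _ n], simp) (rule det_permute_rows[OF A p])
  finally show ?thesis
    by (cases p rule: sign_cases) auto
qed

text \<open>Two enumerations of the same set give matrices conjugate by a permutation. This frees
  the final result from any particular ordering of the vertices of the central graph.\<close>

lemma char_poly_reindex:
  fixes f :: "'b \<Rightarrow> 'b \<Rightarrow> 'a :: comm_ring_1"
  assumes "distinct xs" "distinct ys" "set xs = set ys"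
  shows "char_poly (mat (length xs) (length xs) (\<lambda>(i, j). f (xs ! i) (xs ! j))) =
         char_poly (mat (length ys) (length ys) (\<lambda>(i, j). f (ys ! i) (ys ! j)))"
proof -
  have "mset xs = mset ys"
    using assms set_eq_iff_mset_eq_distinct by blast
  then obtain p where p: "p permutes {..<length ys}" and xs: "permute_list p ys = xs"
    by (rule mset_eq_permutation)
  define n where "n = length ys"
  have len: "length xs = n" "length ys = n"
    using xs by (auto simp: n_def)
  have p': "p permutes {0..<n}"
    using p by (simp add: n_def atLeast0LessThan)
  have pn: "p i < n" if "i < n" for i
    using permutes_in_image[OF p'] that by simp
  have nth: "xs ! i = ys ! p i" if "i < n" for i
    using that xs p permute_list_nth[of p ys i] len by auto
  \<comment> \<open>Injectivity keeps the diagonal on the diagonal, so the indeterminate stays in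
    matching positions of the two characteristic matrices.\<close>
  have inj: "p i = p j \<longleftrightarrow> i = j" for i j
    using permutes_inj[OF p'] by (auto simp: inj_def)
  let ?M = "char_poly_matrix (mat n n (\<lambda>(i, j). f (ys ! i) (ys ! j)))"
  have "char_poly_matrix (mat n n (\<lambda>(i, j). f (xs ! i) (xs ! j))) =
        mat n n (\<lambda>(i, j). ?M $$ (p i, p j))"
    by (rule eq_matI) (auto simp: char_poly_matrix_def pn nth inj)
  then show ?thesis
    using det_permute_rows_cols[of ?M n p, OF _ p'] by (simp add: char_poly_def len)
qed

text \<open>Sylvester's identity. Both products \<open>?M * ?N\<close> and \<open>?N * ?M\<close>
  are block upper triangular with a single nontrivial diagonal block, and they have equal
  determinants.\<close>

lemma det_one_plus_mult_commute:
  fixes A B :: "'a :: idom mat"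
  assumes A: "A \<in> carrier_mat n m" and B: "B \<in> carrier_mat m n"
  shows "det (1\<^sub>m n + A * B) = det (1\<^sub>m m + B * A)"
proof -
  let ?M = "four_block_mat (1\<^sub>m n) (- A) B (1\<^sub>m m)"
  let ?N = "four_block_mat (1\<^sub>m n) (0\<^sub>m n m) (- B) (1\<^sub>m m)"
  have c: "?M \<in> carrier_mat (n + m) (n + m)" "?N \<in> carrier_mat (n + m) (n + m)"
    by auto
  have MN: "?M * ?N = four_block_mat (1\<^sub>m n + A * B) (- A) (0\<^sub>m m n) (1\<^sub>m m)"
    by (subst mult_four_block_mat[of _ n n _ m _ m], insert A B, auto)
  have NM: "?N * ?M = four_block_mat (1\<^sub>m n) (- A) (0\<^sub>m m n) (1\<^sub>m m + B * A)"
    by (subst mult_four_block_mat[of _ n n _ m _ m], insert A B, auto)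
  have "det (1\<^sub>m n + A * B) = det (?M * ?N)"
    unfolding MN using A B by (subst det_four_block_mat_lower_left_zero[of _ n _ m]) auto
  also have "\<dots> = det (?N * ?M)"
    by (simp add: det_mult[OF c] det_mult[OF c(2,1)])
  also have "\<dots> = det (1\<^sub>m m + B * A)"
    unfolding NM using A B by (subst det_four_block_mat_lower_left_zero[of _ n _ m]) auto
  finally show ?thesis .
qed

text \<open>Schur complement with respect to the invertible scalar block: right multiplication by
  the block unitriangular \<open>?N\<close> clears the lower left block without changing the
  determinant.\<close>

lemma det_four_block_mat_scalar_lower_right:
  fixes y :: "'a :: field"
  assumes P: "P \<in> carrier_mat n n" and Q: "Q \<in> carrier_mat n m" and R: "R \<in> carrier_mat m n"
    and y: "y \<noteq> 0"
  shows "det (four_block_mat P Q R (y \<cdot>\<^sub>m 1\<^sub>m m)) = y ^ m * det (P - (1 / y) \<cdot>\<^sub>m (Q * R))"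
proof -
  let ?M = "four_block_mat P Q R (y \<cdot>\<^sub>m 1\<^sub>m m)"
  let ?N = "four_block_mat (1\<^sub>m n) (0\<^sub>m n m) ((- 1 / y) \<cdot>\<^sub>m R) (1\<^sub>m m)"
  have c: "?M \<in> carrier_mat (n + m) (n + m)" "?N \<in> carrier_mat (n + m) (n + m)"
    using P by auto
  have detN: "det ?N = 1"
    using R by (subst det_four_block_mat_upper_right_zero[of _ n _ m]) auto
  have "P * 1\<^sub>m n + Q * ((- 1 / y) \<cdot>\<^sub>m R) = P - (1 / y) \<cdot>\<^sub>m (Q * R)"
    using P Q R by (subst mult_smult_distrib[of _ n m]) (auto intro!: eq_matI)
  moreover have "R * 1\<^sub>m n + y \<cdot>\<^sub>m 1\<^sub>m m * ((- 1 / y) \<cdot>\<^sub>m R) = 0\<^sub>m m n"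
    using R y by (subst mult_smult_assoc_mat[of _ m m]) (auto intro!: eq_matI)
  moreover have "P * 0\<^sub>m n m + Q * 1\<^sub>m m = Q" "R * 0\<^sub>m n m + y \<cdot>\<^sub>m 1\<^sub>m m * 1\<^sub>m m = y \<cdot>\<^sub>m 1\<^sub>m m"
    using P Q R by auto
  ultimately have MN: "?M * ?N =
      four_block_mat (P - (1 / y) \<cdot>\<^sub>m (Q * R)) Q (0\<^sub>m m n) (y \<cdot>\<^sub>m 1\<^sub>m m)"
    by (subst mult_four_block_mat[of _ n n _ m _ m]) (use P Q R in auto)
  have "det ?M = det (?M * ?N)"
    unfolding det_mult[OF c] detN by simp
  also have "\<dots> = det (P - (1 / y) \<cdot>\<^sub>m (Q * R)) * det (y \<cdot>\<^sub>m 1\<^sub>m m)"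
    unfolding MN using P Q R by (subst det_four_block_mat_lower_left_zero[of _ n _ m]) auto
  finally show ?thesis by simp
qed

section \<open>Determinants of matrix pencils and rank-one updates by the all-ones matrix\<close>

text \<open>Rectangular shapes are allowed so that the square matrix J can be factored as a column
  times a row.\<close>

definition ones_mat :: "nat \<Rightarrow> nat \<Rightarrow> 'a :: one mat" where
  "ones_mat n m = mat n m (\<lambda>_. 1)"

lemma ones_mat_carrier [simp]: "ones_mat n m \<in> carrier_mat n m"
  by (simp add: ones_mat_def)

text \<open>J has the rank-one factorization column times row, so Sylvester's identity reduces the
  determinant to size 1.\<close>

lemma det_one_plus_smult_ones:
  fixes c :: "'a :: idom"
  shows "det (1\<^sub>m n + c \<cdot>\<^sub>m ones_mat n n) = 1 + c * of_nat n"
proof -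
  have "c \<cdot>\<^sub>m ones_mat n n = (c \<cdot>\<^sub>m ones_mat n 1) * ones_mat 1 n"
    by (rule eq_matI) (auto simp: ones_mat_def scalar_prod_def)
  then have "det (1\<^sub>m n + c \<cdot>\<^sub>m ones_mat n n) = det (1\<^sub>m 1 + ones_mat 1 n * (c \<cdot>\<^sub>m ones_mat n 1))"
    by (simp add: det_one_plus_mult_commute[of _ n 1])
  also have "1\<^sub>m 1 + ones_mat 1 n * (c \<cdot>\<^sub>m ones_mat n 1) = (1 + c * of_nat n) \<cdot>\<^sub>m 1\<^sub>m 1"
    by (rule eq_matI) (auto simp: ones_mat_def scalar_prod_def mult.commute)
  finally show ?thesis by simp
qed

text \<open>For \<open>b \<noteq> 0\<close> the determinant is \<open>(- b) ^ n\<close> times the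
  characteristic polynomial at \<open>- a / b\<close>, so its factorization into linear factors
  suffices and no eigenbasis is required. The case \<open>b = 0\<close> is a scalar matrix.\<close>

lemma det_pencil_eq_prod:
  fixes A :: "'a :: field mat" and lam :: "nat \<Rightarrow> 'a"
  assumes A: "A \<in> carrier_mat n n" and cp: "char_poly A = (\<Prod>i = 1..n. [:- lam i, 1:])"
  shows "det (a \<cdot>\<^sub>m 1\<^sub>m n + b \<cdot>\<^sub>m A) = (\<Prod>i = 1..n. a + b * lam i)"
proof (cases "b = 0")
  case True
  have "a \<cdot>\<^sub>m 1\<^sub>m n + 0 \<cdot>\<^sub>m A = a \<cdot>\<^sub>m 1\<^sub>m n"
    using A by (auto intro!: eq_matI)
  with True show ?thesis by simp
next
  case False
  have "a \<cdot>\<^sub>m 1\<^sub>m n + b \<cdot>\<^sub>m A = (- b) \<cdot>\<^sub>m (- char_matrix A (- a / b))"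
    using A False by (auto intro!: eq_matI simp: char_matrix_def field_simps)
  then have "det (a \<cdot>\<^sub>m 1\<^sub>m n + b \<cdot>\<^sub>m A) = (- b) ^ n * poly (char_poly A) (- a / b)"
    using A by (simp add: char_poly_matrix[OF A] char_matrix_def)
  also have "\<dots> = (\<Prod>i = 1..n. - b) * (\<Prod>i = 1..n. - lam i - a / b)"
    unfolding cp poly_prod by simp
  also have "\<dots> = (\<Prod>i = 1..n. a + b * lam i)"
    unfolding prod.distrib[symmetric] using False by (intro prod.cong refl) (simp add: field_simps)
  finally show ?thesis .
qed

text \<open>The J term affects only the factor of \<open>lam 1\<close>, the eigenvalue on the
  columns of J; this is how the values \<open>P i\<close> enter the product.\<close>

lemma det_pencil_plus_ones:
  fixes A :: "'a :: field mat" and lam :: "nat \<Rightarrow> 'a"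
  assumes A: "A \<in> carrier_mat n n" and cp: "char_poly A = (\<Prod>i = 1..n. [:- lam i, 1:])"
    and AJ: "A * ones_mat n n = lam 1 \<cdot>\<^sub>m ones_mat n n"
    and n: "n \<ge> 1" and nz: "a + b * lam 1 \<noteq> 0"
  shows "det (a \<cdot>\<^sub>m 1\<^sub>m n + b \<cdot>\<^sub>m A + c \<cdot>\<^sub>m ones_mat n n) =
         (a + b * lam 1 + c * of_nat n) * (\<Prod>i = 2..n. a + b * lam i)"
proof -
  let ?J = "ones_mat n n :: 'a mat"
  \<comment> \<open>Since \<open>?X * ?J\<close> is \<open>(a + b * lam 1)\<close> times
    \<open>?J\<close>, this scalar makes \<open>?X * (1\<^sub>m n + ?d \<cdot>\<^sub>m ?J)\<close>
    equal to \<open>?X + c \<cdot>\<^sub>m ?J\<close>.\<close>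
  let ?d = "c / (a + b * lam 1)"
  let ?X = "a \<cdot>\<^sub>m 1\<^sub>m n + b \<cdot>\<^sub>m A"
  have X: "?X \<in> carrier_mat n n" using A by auto
  have "?X * ?J = a \<cdot>\<^sub>m ?J + b \<cdot>\<^sub>m (A * ?J)"
    using A by (simp add: add_mult_distrib_mat[of _ n n _ _ n] mult_smult_assoc_mat[of _ n n _ n]
        left_mult_one_mat[of _ n n])
  also have "\<dots> = (a + b * lam 1) \<cdot>\<^sub>m ?J"
    unfolding AJ by (rule eq_matI) (auto simp: algebra_simps)
  finally have XJ: "?X * ?J = (a + b * lam 1) \<cdot>\<^sub>m ?J" .
  have "?X * (1\<^sub>m n + ?d \<cdot>\<^sub>m ?J) = ?X + ?d \<cdot>\<^sub>m (?X * ?J)"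
    using X by (simp add: mult_add_distrib_mat[of _ n n _ n] mult_smult_distrib[of _ n n _ n]
        right_mult_one_mat[of _ n n])
  also have "\<dots> = ?X + c \<cdot>\<^sub>m ?J"
    unfolding XJ using A nz by (auto intro!: eq_matI)
  finally have "det (?X + c \<cdot>\<^sub>m ?J) = det ?X * (1 + ?d * of_nat n)"
    using det_mult[OF X, of "1\<^sub>m n + ?d \<cdot>\<^sub>m ?J"] by (simp add: det_one_plus_smult_ones)
  also have "det ?X = (a + b * lam 1) * (\<Prod>i = 2..n. a + b * lam i)"
    unfolding det_pencil_eq_prod[OF A cp] using n
    by (simp add: prod.atLeast_Suc_atMost numeral_2_eq_2)
  finally have "det (?X + c \<cdot>\<^sub>m ?J) =
      (a + b * lam 1) * (1 + ?d * of_nat n) * (\<Prod>i = 2..n. a + b * lam i)"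
    by (simp add: ac_simps)
  also have "(a + b * lam 1) * (1 + ?d * of_nat n) = a + b * lam 1 + c * of_nat n"
    using nz by (simp add: distrib_left)
  finally show ?thesis .
qed


section \<open>The normalized Laplacian of a central graph\<close>

lemma degree_of_eq_card: "degree_of G v = card {u. (v, u) \<in> parcs G}"
proof -
  have "out_arcs (with_proj G) v = Pair v ` {u. (v, u) \<in> parcs G}"
    by (auto simp: out_arcs_def)
  then show ?thesis
    by (simp add: degree_of_def out_degree_def card_image inj_on_def)
qed

context pair_graph
begin

lemma parcs_sym: "(u, v) \<in> parcs G \<longleftrightarrow> (v, u) \<in> parcs G"
  using arcs_symmetric by blast

lemma parcs_irrefl: "(v, v) \<notin> parcs G"
  using pair_no_loops by fastforce

lemma doubleton_in_uedges_iff: "{u, v} \<in> uedges G \<longleftrightarrow> (u, v) \<in> parcs G"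
  using parcs_sym by (auto simp: uedges_def doubleton_eq_iff)

lemma card_uedge: "e \<in> uedges G \<Longrightarrow> card e = 2"
  using parcs_irrefl by (auto simp: uedges_def card_insert_if)

lemma uedge_eq_doubleton: "e \<in> uedges G \<Longrightarrow> u \<in> e \<Longrightarrow> v \<in> e \<Longrightarrow> u \<noteq> v \<Longrightarrow> e = {u, v}"
  by (auto simp: uedges_def)

text \<open>Sending a neighbour \<open>u\<close> to \<open>{v, u}\<close> is a bijection onto the
  edges at \<open>v\<close>. This yields the diagonal of \<open>B * transpose_mat B\<close> for the
  incidence matrix \<open>B\<close>.\<close>

lemma card_incident_uedges: "card {e \<in> uedges G. v \<in> e} = degree_of G v"
proof -
  have "{e \<in> uedges G. v \<in> e} = (\<lambda>u. {v, u}) ` {u. (v, u) \<in> parcs G}"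
  proof (intro equalityI subsetI)
    fix e assume e: "e \<in> {e \<in> uedges G. v \<in> e}"
    then obtain a b where ab: "e = {a, b}" "(a, b) \<in> parcs G"
      by (auto simp: uedges_def)
    with e have "v = a \<or> v = b" by auto
    with ab show "e \<in> (\<lambda>u. {v, u}) ` {u. (v, u) \<in> parcs G}"
      using parcs_sym[of a b] by auto
  qed (auto simp: doubleton_in_uedges_iff)
  then show ?thesis
    by (simp add: degree_of_eq_card card_image inj_on_def doubleton_eq_iff)
qed

text \<open>Two distinct vertices determine the only edge that can contain both; this yields the
  off-diagonal entries of \<open>B * transpose_mat B\<close>.\<close>

lemma card_uedges_containing_pair:
  assumes "u \<noteq> v"
  shows "card {e \<in> uedges G. u \<in> e \<and> v \<in> e} = (if (u, v) \<in> parcs G then 1 else 0)"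
proof -
  have "{e \<in> uedges G. u \<in> e \<and> v \<in> e} = (if (u, v) \<in> parcs G then {{u, v}} else {})"
    using assms uedge_eq_doubleton[of _ u v] doubleton_in_uedges_iff[of u v] by auto
  then show ?thesis by simp
qed

text \<open>Each neighbour of \<open>v\<close> is traded for the vertex subdividing the joining
  edge, and each non-neighbour becomes a neighbour. Hence every vertex other than \<open>v\<close>
  contributes exactly one, whatever the degree of \<open>v\<close> in \<open>G\<close>.\<close>

lemma degree_central_Inl:
  assumes v: "v \<in> pverts G"
  shows "degree_of (central_graph G) (Inl v) = card (pverts G) - 1"
proof -
  let ?N = "{u. (v, u) \<in> parcs G}" and ?M = "{u \<in> pverts G. u \<noteq> v \<and> (v, u) \<notin> parcs G}"
  let ?E = "{e \<in> uedges G. v \<in> e}"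
  have fin: "finite ?N" "finite ?M" "finite ?E"
    using pair_finite_verts finite_uedges
    by (auto intro: finite_subset[of ?N "pverts G"] dest: in_arcsD2)
  have "{u. (Inl v, u) \<in> parcs (central_graph G)} = Inl ` ?M \<union> Inr ` ?E"
    using v by (auto simp: central_graph_def)
  also have "card \<dots> = card ?M + card ?E"
    using fin by (subst card_Un_disjoint) (auto simp: card_image)
  also have "\<dots> = card ?M + card ?N"
    by (simp add: card_incident_uedges degree_of_eq_card)
  also have "\<dots> = card (?M \<union> ?N)"
    using fin by (subst card_Un_disjoint) auto
  also have "?M \<union> ?N = pverts G - {v}"
    using parcs_irrefl by (auto dest: in_arcsD2)
  finally show ?thesis
    using v by (simp add: degree_of_eq_card)
qed

lemma degree_central_Inr:
  assumes e: "e \<in> uedges G"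
  shows "degree_of (central_graph G) (Inr e) = 2"
proof -
  have "{u. (Inr e, u) \<in> parcs (central_graph G)} = Inl ` e"
    using e by (auto simp: central_graph_def)
  then show ?thesis
    using card_uedge[OF e] by (simp add: degree_of_eq_card card_image)
qed

end

section \<open>The incidence matrix and the block form of the Laplacian\<close>

definition incidence_matrix :: "'a list \<Rightarrow> 'a set list \<Rightarrow> real mat" where
  "incidence_matrix vs es = mat (length vs) (length es) (\<lambda>(i, j). of_bool (vs ! i \<in> es ! j))"

lemma sum_nth_distinct:
  assumes "distinct xs"
  shows "(\<Sum>i = 0..<length xs. f (xs ! i)) = sum f (set xs)"
  using sum.reindex_bij_betw[OF bij_betw_nth[OF assms refl refl], of f]
  by (simp add: atLeast0LessThan)

lemma vertex_enumD:
  assumes "vertex_enum G vs"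
  shows "length vs = card (pverts G)" "i < length vs \<Longrightarrow> vs ! i \<in> pverts G"
    "i < length vs \<Longrightarrow> j < length vs \<Longrightarrow> vs ! i = vs ! j \<longleftrightarrow> i = j"
  using assms distinct_card[of vs] nth_mem[of i vs] nth_eq_iff_index_eq[of vs i j]
  unfolding vertex_enum_def by metis+

context pair_graph
begin

text \<open>By regularity every row sums to \<open>r\<close>. This is the eigenvector hypothesis of
  \<open>det_pencil_plus_ones\<close> with \<open>lam 1 = r\<close>.\<close>

lemma adjacency_matrix_mult_ones:
  assumes reg: "regular_graph G r" and vs: "vertex_enum G vs" and n: "n = length vs"
  shows "adjacency_matrix G vs * ones_mat n n = real r \<cdot>\<^sub>m ones_mat n n"
proof (rule eq_matI)
  fix i j assume "i < dim_row (real r \<cdot>\<^sub>m ones_mat n n)" "j < dim_col (real r \<cdot>\<^sub>m ones_mat n n)"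
  then have i: "i < n" and j: "j < n" by (auto simp: ones_mat_def)
  have "(adjacency_matrix G vs * ones_mat n n) $$ (i, j) =
        (\<Sum>k = 0..<length vs. of_bool ((vs ! i, vs ! k) \<in> parcs G))"
    using i j n by (simp add: adjacency_matrix_def ones_mat_def scalar_prod_def of_bool_def)
  also have "\<dots> = (\<Sum>u\<in>pverts G. of_bool ((vs ! i, u) \<in> parcs G))"
    using vs sum_nth_distinct[of vs "\<lambda>u. of_bool ((vs ! i, u) \<in> parcs G) :: real"]
    by (simp add: vertex_enum_def)
  also have "\<dots> = real (card {u \<in> pverts G. (vs ! i, u) \<in> parcs G})"
    using pair_finite_verts by (simp add: Collect_conj_eq)
  also have "{u \<in> pverts G. (vs ! i, u) \<in> parcs G} = {u. (vs ! i, u) \<in> parcs G}"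
    by (auto dest: in_arcsD2)
  also have "real (card \<dots>) = real r"
    using reg vertex_enumD(2)[OF vs, of i] i n
    by (simp add: regular_graph_def degree_of_eq_card)
  finally show "(adjacency_matrix G vs * ones_mat n n) $$ (i, j) = (real r \<cdot>\<^sub>m ones_mat n n) $$ (i, j)"
    using i j by (simp add: ones_mat_def)
qed (use n in \<open>auto simp: adjacency_matrix_def ones_mat_def\<close>)

text \<open>Entry \<open>(i, j)\<close> counts the edges containing both vertices: the degree on the
  diagonal, adjacency off it.\<close>

lemma incidence_matrix_mult_transpose:
  assumes reg: "regular_graph G r" and vs: "vertex_enum G vs" and n: "n = length vs"
    and es: "distinct es" "set es = uedges G"
  shows "incidence_matrix vs es * transpose_mat (incidence_matrix vs es) =
         adjacency_matrix G vs + real r \<cdot>\<^sub>m 1\<^sub>m n" (is "?L = ?R")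
proof (rule eq_matI)
  fix i j assume "i < dim_row ?R" "j < dim_col ?R"
  then have i: "i < n" and j: "j < n" by auto
  have "?L $$ (i, j) = (\<Sum>k = 0..<length es. of_bool (vs ! i \<in> es ! k \<and> vs ! j \<in> es ! k))"
    using i j n by (simp add: incidence_matrix_def scalar_prod_def of_bool_conj
        del: sum_of_bool_eq sum_mult_of_bool_eq sum_of_bool_mult_eq)
  also have "\<dots> = (\<Sum>e\<in>uedges G. of_bool (vs ! i \<in> e \<and> vs ! j \<in> e))"
    using es sum_nth_distinct[of es "\<lambda>e. of_bool (vs ! i \<in> e \<and> vs ! j \<in> e) :: real"] by simp
  also have "\<dots> = real (card {e \<in> uedges G. vs ! i \<in> e \<and> vs ! j \<in> e})"
    using finite_uedges by (simp add: Collect_conj_eq)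
  also have "\<dots> = ?R $$ (i, j)"
  proof (cases "i = j")
    case True
    then show ?thesis
      using i n reg vertex_enumD(2)[OF vs, of i]
      by (simp add: adjacency_matrix_def card_incident_uedges regular_graph_def parcs_irrefl)
  next
    case False
    then have "vs ! i \<noteq> vs ! j"
      using vertex_enumD(3)[OF vs] i j n by simp
    with False show ?thesis
      using i j n by (simp add: adjacency_matrix_def card_uedges_containing_pair)
  qed
  finally show "?L $$ (i, j) = ?R $$ (i, j)" .
qed (use n in \<open>auto simp: adjacency_matrix_def incidence_matrix_def\<close>)

text \<open>The weights come from the degrees \<open>n - 1\<close> of original vertices and 2 of
  subdivision vertices. The matrix \<open>ones_mat n n - 1\<^sub>m n - A\<close> is the adjacency
  matrix of the complement of \<open>G\<close>, and subdivision vertices are pairwise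
  non-adjacent.\<close>

lemma normalized_laplacian_central:
  assumes vs: "vertex_enum G vs" and n: "n = length vs" and n2: "n \<ge> 2"
    and es: "distinct es" "set es = uedges G" "length es = m"
  defines "s \<equiv> 1 / sqrt (2 * (real n - 1))"
    and "A \<equiv> adjacency_matrix G vs" and "B \<equiv> incidence_matrix vs es"
  shows "normalized_laplacian (central_graph G) (map Inl vs @ map Inr es) =
     four_block_mat (1\<^sub>m n - (1 / (real n - 1)) \<cdot>\<^sub>m (ones_mat n n - 1\<^sub>m n - A)) (- s \<cdot>\<^sub>m B)
       (- s \<cdot>\<^sub>m transpose_mat B) (1\<^sub>m m)"
    (is "normalized_laplacian ?C ?ws = ?F")
proof (rule eq_matI)
  have dimA: "dim_row A = n" "dim_col A = n" and dimB: "dim_row B = n" "dim_col B = m"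
    using n es by (auto simp: A_def B_def adjacency_matrix_def incidence_matrix_def)
  then show "dim_row (normalized_laplacian ?C ?ws) = dim_row ?F"
    "dim_col (normalized_laplacian ?C ?ws) = dim_col ?F"
    using n es by (auto simp: normalized_laplacian_def)
  fix i j assume "i < dim_row ?F" "j < dim_col ?F"
  then have i: "i < n + m" and j: "j < n + m" using dimA by auto
  have vs_in: "vs ! k \<in> pverts G" if "k < n" for k
    using vertex_enumD(2)[OF vs] that n by simp
  have es_in: "es ! k \<in> uedges G" if "k < m" for k
    using es that nth_mem by blast
  have deg1: "degree_of ?C (Inl (vs ! k)) = n - 1" if "k < n" for k
    using degree_central_Inl[OF vs_in[OF that]] vertex_enumD(1)[OF vs] n by simp
  have deg2: "degree_of ?C (Inr (es ! k)) = 2" if "k < m" for k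
    using degree_central_Inr[OF es_in[OF that]] .
  define w where "w = ?ws"
  have nth1: "w ! k = Inl (vs ! k)" if "k < n" for k
    using that n by (simp add: w_def nth_append)
  have nth2: "w ! k = Inr (es ! (k - n))" if "\<not> k < n" "k < n + m" for k
    using that n es by (auto simp: w_def nth_append)
  have len: "length w = n + m" using n es by (simp add: w_def)
  have rn: "real (n - 1) = real n - 1" using n2 by simp
  \<comment> \<open>No vertex is isolated, because \<open>n \<ge> 2\<close>; so every diagonal entry
    is 1.\<close>
  have deg0: "degree_of ?C (w ! k) \<noteq> 0" if "k < n + m" for k
    using that n2 deg1 deg2 by (cases "k < n") (simp_all add: nth1 nth2)
  have entry: "normalized_laplacian ?C w $$ (i, j) =
      (if i = j then 1 else if (w ! i, w ! j) \<in> parcs ?C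
        then - 1 / sqrt (real (degree_of ?C (w ! i)) * real (degree_of ?C (w ! j))) else 0)"
    unfolding normalized_laplacian_def len using i j deg0[OF i] by simp
  have A_entry: "A $$ (k, l) = (if (vs ! k, vs ! l) \<in> parcs G then 1 else 0)" if "k < n" "l < n" for k l
    using that n by (simp add: A_def adjacency_matrix_def)
  have B_entry: "B $$ (k, l) = of_bool (vs ! k \<in> es ! l)" if "k < n" "l < m" for k l
    using that n es(3) by (simp add: B_def incidence_matrix_def)
  have "normalized_laplacian ?C w $$ (i, j) = ?F $$ (i, j)"
  proof (cases "i < n"; cases "j < n")
    assume ij: "i < n" "j < n"
    have arc: "(Inl (vs ! i), Inl (vs ! j)) \<in> parcs ?C \<longleftrightarrow> i \<noteq> j \<and> (vs ! i, vs ! j) \<notin> parcs G"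
      using ij vs_in vertex_enumD(3)[OF vs] n by (auto simp: central_graph_def)
    have "normalized_laplacian ?C w $$ (i, j) =
        (if i = j then 1 else if (vs ! i, vs ! j) \<in> parcs G then 0 else - 1 / (real n - 1))"
      unfolding entry using ij n2 by (simp add: nth1 deg1 arc rn)
    then show ?thesis
      using ij by (simp add: dimA dimB A_entry ones_mat_def parcs_irrefl)
  next
    assume ij: "i < n" "\<not> j < n"
    then have arc: "(Inl (vs ! i), Inr (es ! (j - n))) \<in> parcs ?C \<longleftrightarrow> vs ! i \<in> es ! (j - n)"
      using j es_in[of "j - n"] by (auto simp: central_graph_def)
    have "normalized_laplacian ?C w $$ (i, j) = - s * of_bool (vs ! i \<in> es ! (j - n))"
      unfolding entry using ij j by (auto simp: nth1 nth2 deg1 deg2 arc rn s_def mult.commute)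
    then show ?thesis
      using ij j by (simp add: dimA dimB B_entry)
  next
    assume ij: "\<not> i < n" "j < n"
    then have arc: "(Inr (es ! (i - n)), Inl (vs ! j)) \<in> parcs ?C \<longleftrightarrow> vs ! j \<in> es ! (i - n)"
      using i es_in[of "i - n"] by (auto simp: central_graph_def)
    have "normalized_laplacian ?C w $$ (i, j) = - s * of_bool (vs ! j \<in> es ! (i - n))"
      unfolding entry using ij i by (auto simp: nth1 nth2 deg1 deg2 arc rn s_def)
    then show ?thesis
      using ij i by (simp add: dimA dimB B_entry)
  next
    assume ij: "\<not> i < n" "\<not> j < n"
    have arc: "(Inr e, Inr e') \<notin> parcs ?C" for e e'
      by (auto simp: central_graph_def)
    have "i - n = j - n \<longleftrightarrow> i = j" using ij by arith
    moreover have "normalized_laplacian ?C w $$ (i, j) = (if i = j then 1 else 0)"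
      unfolding entry using ij i j by (simp add: nth2 arc)
    moreover have "i - n < m" "j - n < m" using ij i j by arith+
    ultimately show ?thesis
      using ij i j by (simp add: dimA dimB)
  qed
  then show "normalized_laplacian ?C ?ws $$ (i, j) = ?F $$ (i, j)"
    by (simp only: w_def)
qed

text \<open>The argument \<open>y + 1\<close> turns \<open>x - 1\<close> into \<open>y\<close>. The
  factor \<open>y ^ n\<close> clears the denominators \<open>y\<close> of the Schur complement, and
  \<open>a\<close>, \<open>b\<close> collect the coefficients of the identity and of the adjacency
  matrix. The lower bound on \<open>y\<close> ensures \<open>a + b * lam 1 > 0\<close>.\<close>

lemma poly_char_poly_normalized_laplacian_central:
  assumes reg: "regular_graph G r" and vs: "vertex_enum G vs" and n: "n = length vs" and n2: "n \<ge> 2"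
    and es: "distinct es" "set es = uedges G" "length es = m"
    and cp: "char_poly (adjacency_matrix G vs) = (\<Prod>i = 1..n. [:- lam i, 1:])"
    and lam1: "lam 1 = real r"
    and y: "y \<ge> 2 * (real r + 1)"
  defines "a \<equiv> y\<^sup>2 - y / (real n - 1) - real r / (2 * (real n - 1))"
    and "b \<equiv> - y / (real n - 1) - 1 / (2 * (real n - 1))"
  shows "y ^ n * poly (char_poly (normalized_laplacian (central_graph G) (map Inl vs @ map Inr es))) (y + 1) =
         y ^ m * ((a + b * real r + y / (real n - 1) * real n) * (\<Prod>i = 2..n. a + b * lam i))"
proof -
  define s where "s = 1 / sqrt (2 * (real n - 1))"
  define A where "A = adjacency_matrix G vs"
  define B where "B = incidence_matrix vs es"
  let ?J = "ones_mat n n :: real mat"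
  let ?L = "normalized_laplacian (central_graph G) (map Inl vs @ map Inr es)"
  let ?P = "y \<cdot>\<^sub>m 1\<^sub>m n + (1 / (real n - 1)) \<cdot>\<^sub>m (?J - 1\<^sub>m n - A)"
  have A: "A \<in> carrier_mat n n" and B: "B \<in> carrier_mat n m"
    using n es by (auto simp: A_def B_def adjacency_matrix_def incidence_matrix_def)
  have L: "?L \<in> carrier_mat (n + m) (n + m)"
    using n es by (auto simp: normalized_laplacian_def)
  have y0: "y > 0" using y by simp
  define d where "d = 1 / (real n - 1)"
  have d: "c / (real n - 1) = c * d" "c / (2 * (real n - 1)) = c * d / 2" for c
    by (simp_all add: d_def)
  have ss: "s * s = 1 / (2 * (real n - 1))"
    using n2 by (simp add: s_def)
  \<comment> \<open>The unit diagonal of the Laplacian cancels the 1 in \<open>y + 1\<close>, which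
    leaves \<open>y\<close> times the identity in the edge block.\<close>
  have "- char_matrix ?L (y + 1) = four_block_mat ?P (s \<cdot>\<^sub>m B) (s \<cdot>\<^sub>m transpose_mat B) (y \<cdot>\<^sub>m 1\<^sub>m m)"
    unfolding normalized_laplacian_central[OF vs n n2 es, folded s_def A_def B_def] char_matrix_def
    using A B by (intro eq_matI) auto
  then have "poly (char_poly ?L) (y + 1) =
      y ^ m * det (?P - (1 / y) \<cdot>\<^sub>m ((s \<cdot>\<^sub>m B) * (s \<cdot>\<^sub>m transpose_mat B)))"
    unfolding char_poly_matrix[OF L] using A B y0
    by (simp only:) (rule det_four_block_mat_scalar_lower_right, auto)
  also have "(s \<cdot>\<^sub>m B) * (s \<cdot>\<^sub>m transpose_mat B) = (s * s) \<cdot>\<^sub>m (B * transpose_mat B)"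
    using B by (simp add: mult_smult_assoc_mat[of _ n m _ n] mult_smult_distrib[of _ n m _ n])
      (auto intro!: eq_matI)
  also have "B * transpose_mat B = A + real r \<cdot>\<^sub>m 1\<^sub>m n"
    unfolding A_def B_def by (rule incidence_matrix_mult_transpose[OF reg vs n es(1,2)])
  finally have poly_eq: "poly (char_poly ?L) (y + 1) =
      y ^ m * det (?P - (1 / y) \<cdot>\<^sub>m ((s * s) \<cdot>\<^sub>m (A + real r \<cdot>\<^sub>m 1\<^sub>m n)))" (is "_ = _ * det ?S") .
  have S: "?S \<in> carrier_mat n n" using A by auto
  have "y \<cdot>\<^sub>m ?S = a \<cdot>\<^sub>m 1\<^sub>m n + b \<cdot>\<^sub>m A + (y / (real n - 1)) \<cdot>\<^sub>m ?J"
    unfolding ss a_def b_def d using A y0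
    by (intro eq_matI) (auto simp: ones_mat_def field_simps power2_eq_square)
  then have "y ^ n * det ?S = det (a \<cdot>\<^sub>m 1\<^sub>m n + b \<cdot>\<^sub>m A + (y / (real n - 1)) \<cdot>\<^sub>m ?J)"
    using S det_smult[of y ?S] by simp
  also have "\<dots> = (a + b * lam 1 + y / (real n - 1) * of_nat n) * (\<Prod>i = 2..n. a + b * lam i)"
  proof (rule det_pencil_plus_ones[OF A])
    show "char_poly A = (\<Prod>i = 1..n. [:- lam i, 1:])" using cp by (simp add: A_def)
    show "A * ?J = lam 1 \<cdot>\<^sub>m ?J"
      unfolding A_def lam1 by (rule adjacency_matrix_mult_ones[OF reg vs n])
    show "n \<ge> 1" using n2 by simp
    \<comment> \<open>Here \<open>a + b * lam 1\<close> equals \<open>y * y\<close> minus the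
      left-hand side; dropping the denominator, which is at least 1, reduces positivity to a bound
      free of \<open>n\<close>.\<close>
    have "(y * (real r + 1) + real r) / (real n - 1) \<le> (y * (real r + 1) + real r) / 1"
      using n2 y0 by (intro divide_left_mono) auto
    also have "\<dots> < y * y"
    proof -
      have "y * (2 * (real r + 1)) \<le> y * y" using y y0 by (intro mult_left_mono) auto
      moreover have "(real r + 1) * 1 \<le> (real r + 1) * y" using y by (intro mult_left_mono) auto
      ultimately show ?thesis by (simp add: algebra_simps)
    qed
    finally have "a + b * lam 1 > 0"
      unfolding a_def b_def lam1 d by (simp add: power2_eq_square algebra_simps)
    then show "a + b * lam 1 \<noteq> 0" by simp
  qed
  finally show ?thesis
    unfolding poly_eq lam1 by (simp add: mult.left_commute)
qed

end

section \<open>From values at large arguments to the identity of rational functions\<close>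

text \<open>The difference vanishes on a whole ray, hence has infinitely many roots. This extends
  the evaluation from large arguments to all of them.\<close>

lemma poly_eqI_at_top:
  fixes p q :: "real poly"
  assumes "\<And>x. x \<ge> c \<Longrightarrow> poly p x = poly q x"
  shows "p = q"
proof (rule ccontr)
  assume "p \<noteq> q"
  then have "finite {x. poly (p - q) x = 0}"
    by (intro poly_roots_finite) simp
  moreover have "{c..} \<subseteq> {x. poly (p - q) x = 0}"
    using assms by auto
  ultimately show False
    using infinite_Ici[of c] finite_subset by blast
qed

lemma power_int_diff_cancel:
  fixes x :: "'a :: field"
  assumes "x \<noteq> 0" and "x ^ n * a = x ^ m * b"
  shows "a = x powi (int m - int n) * b"
  using assms by (simp add: power_int_diff nonzero_eq_divide_eq ac_simps)

text \<open>The exponent \<open>m - n\<close> is negative when \<open>r < 2\<close>, so the identity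
  lives in the field of fractions of the real polynomials. The eigenvalues with their multiplicities
  are given by the factorization of the characteristic polynomial.\<close>

theorem theorem3p1:
  fixes G :: "'a pair_pre_digraph"
    and n m r :: nat
    and vs :: "'a list" and ws :: "('a + 'a set) list"
    and lam P :: "nat \<Rightarrow> real"
  assumes "regular_graph G r"
    and "n = card (pverts G)" and "n \<ge> 2"
    and "m = card (uedges G)"
    and "vertex_enum G vs"
    and "vertex_enum (central_graph G) ws"
    and "char_poly (adjacency_matrix G vs) = (\<Prod>i = 1..n. [:- lam i, 1:])"
    and "lam 1 = real r"
    and "\<And>i j. 1 \<le> i \<Longrightarrow> i \<le> j \<Longrightarrow> j \<le> n \<Longrightarrow> lam j \<le> lam i"
    and "P 1 = real n"
    and "\<And>i. 2 \<le> i \<Longrightarrow> i \<le> n \<Longrightarrow> P i = 0"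
  shows "to_fract (char_poly (normalized_laplacian (central_graph G) ws)) =
           (to_fract [:-1, 1:]) powi (int m - int n) *
           to_fract (\<Prod>i = 1..n.
             [:-1, 1:] * ([:-1, 1:] + [:(P i - 1 - lam i) / (real n - 1):])
               - [:(lam i + real r) / (2 * (real n - 1)):])"
proof -
  interpret pair_graph G
    using assms(1) by (simp add: regular_graph_def)
  obtain es where es: "distinct es" "set es = uedges G"
    using finite_distinct_list[OF finite_uedges] by blast
  have lenes: "length es = m"
    using es assms(4) distinct_card by fastforce
  have n: "n = length vs"
    using vertex_enumD(1)[OF assms(5)] assms(2) by simp
  let ?ws = "map Inl vs @ map Inr es"
  let ?X = "[:-1, 1:] :: real poly"
  let ?f = "char_poly (normalized_laplacian (central_graph G) ws)"
  let ?F = "\<lambda>i. ?X * (?X + [:(P i - 1 - lam i) / (real n - 1):])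
               - [:(lam i + real r) / (2 * (real n - 1)):]"
  have ws': "distinct ?ws" "set ?ws = pverts (central_graph G)"
    using es assms(5) by (auto simp: vertex_enum_def distinct_map central_graph_def)
  have f: "?f = char_poly (normalized_laplacian (central_graph G) ?ws)"
  proof -
    \<comment> \<open>Comparing vertices instead of indices on the diagonal makes each entry a
      function of the two labels alone, as \<open>char_poly_reindex\<close> requires; the two
      readings agree on a distinct list.\<close>
    let ?g = "\<lambda>C x y. if x = y \<and> degree_of C x \<noteq> 0 then 1
        else if (x, y) \<in> parcs C then - 1 / sqrt (real (degree_of C x) * real (degree_of C y)) else 0"
    have nl: "normalized_laplacian C xs = mat (length xs) (length xs) (\<lambda>(i, j). ?g C (xs ! i) (xs ! j))"
      if "distinct xs" for C :: "('a + 'a set) pair_pre_digraph" and xs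
      using that by (intro eq_matI) (auto simp: normalized_laplacian_def nth_eq_iff_index_eq)
    have ws: "distinct ws" "set ws = pverts (central_graph G)"
      using assms(6) by (auto simp: vertex_enum_def)
    show ?thesis
      unfolding nl[OF ws(1)] nl[OF ws'(1)]
      by (rule char_poly_reindex) (use ws ws' in auto)
  qed
  \<comment> \<open>With the negative power moved to the left, this is an identity of polynomials
    and can be checked pointwise.\<close>
  have "?X ^ n * ?f = ?X ^ m * (\<Prod>i = 1..n. ?F i)"
  proof (rule poly_eqI_at_top)
    fix x assume x: "x \<ge> 2 * (real r + 1) + 1"
    define y where "y = x - 1"
    let ?a = "y\<^sup>2 - y / (real n - 1) - real r / (2 * (real n - 1))"
    let ?b = "- y / (real n - 1) - 1 / (2 * (real n - 1))"
    have split: "(\<Prod>i = 1..n. g i) = g 1 * (\<Prod>i = 2..n. g i)" for g :: "nat \<Rightarrow> real"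
      using assms(3) by (simp add: prod.atLeast_Suc_atMost numeral_2_eq_2)
    define d where "d = 1 / (real n - 1)"
    have d: "c / (real n - 1) = c * d" "c / (2 * (real n - 1)) = c * d / 2" for c
      by (simp_all add: d_def)
    \<comment> \<open>The last summand is the contribution of \<open>P 1 = n\<close>; in the
      remaining factors \<open>P i = 0\<close> leaves only the pencil term.\<close>
    have F1: "poly (?F 1) x = ?a + ?b * real r + y / (real n - 1) * real n"
      unfolding assms(8,10) d by (simp add: y_def algebra_simps power2_eq_square)
    have F2: "poly (?F i) x = ?a + ?b * lam i" if "i \<in> {2..n}" for i
      unfolding d using that by (simp add: assms(11) y_def field_simps power2_eq_square)
    have "poly (\<Prod>i = 1..n. ?F i) x =
        (?a + ?b * real r + y / (real n - 1) * real n) * (\<Prod>i = 2..n. ?a + ?b * lam i)"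
      unfolding poly_prod split F1 using F2 by simp
    moreover have "y ^ n * poly ?f (y + 1) =
        y ^ m * ((?a + ?b * real r + y / (real n - 1) * real n) * (\<Prod>i = 2..n. ?a + ?b * lam i))"
      unfolding f using x
      by (intro poly_char_poly_normalized_laplacian_central[OF assms(1,5) n assms(3) es lenes assms(7,8)])
        (simp add: y_def)
    ultimately show "poly (?X ^ n * ?f) x = poly (?X ^ m * (\<Prod>i = 1..n. ?F i)) x"
      by (simp add: y_def)
  qed
  then have "to_fract (?X ^ n * ?f) = to_fract (?X ^ m * (\<Prod>i = 1..n. ?F i))"
    by (rule arg_cong)
  moreover have pow: "to_fract (p ^ k) = to_fract p ^ k" for p :: "real poly" and k
    by (induction k) simp_all
  ultimately have "to_fract ?X ^ n * to_fract ?f = to_fract ?X ^ m * to_fract (\<Prod>i = 1..n. ?F i)"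
    by (simp only: to_fract_mult pow)
  then show ?thesis
    by (rule power_int_diff_cancel[rotated]) simp
qed

end
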